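(* Let $(\mathcal H,[\cdot,\cdot])$ be a Krein space, let $B\in CR(\mathcal H)$ and $C\in L(\mathcal H)$. Suppose that $R(B)$ and $N(B^{\#}B)$ are nonnegative pseudo-regular subspaces and that $R(C)\subseteq\overline{B(N(B^{\#}B)^{[\perp]})+R(B)^{[\perp]}}$. Let $Q\in\mathcal Q_{R(B)}$, put $B'=Q^{\#}B$, and let $D\in L(\mathcal H)$ be a solution of the system $$\begin{cases} B'XB'=B',\quad XB'X=X,\\ B'X=Q^{\#}Q,\\ (XB')^{\#}(XB')=(XB')(XB')^{\#}.\end{cases}$$ Set $X_1=DC$. Then $X_1$ is a solution of the problem $\min_{X\in\mathcal M_C}X^{\#}X$; that is, $X_1\in\mathcal M_C$ and $X_1^{\#}X_1\le X^{\#}X$ for every $X\in\mathcal M_C$, where $\mathcal M_C$ is the set of indefinite minimum solutions (ImS) of $BX-C=0$.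
   Context: A Krein space is a complex vector space $\mathcal H$ with a Hermitian sesquilinear form $[\cdot,\cdot]$ admitting a fundamental decomposition $\mathcal H=\mathcal H_+[\dotplus]\mathcal H_-$ (direct and $[\cdot,\cdot]$-orthogonal) with $(\mathcal H_+,[\cdot,\cdot])$ and $(\mathcal H_-,-[\cdot,\cdot])$ (separable) Hilbert spaces; the direct sum of these Hilbert spaces gives a Hilbert space norm on $\mathcal H$, and all such norms are equivalent (closures refer to this norm topology). $L(\mathcal H)$ is the space of linear operators on $\mathcal H$ bounded with respect to such a norm; $CR(\mathcal H)$ is the set of those with closed range. $R(A)$, $N(A)$ are the range and null space of $A$. For $T\in L(\mathcal H)$, $T^{\#}$ is the unique operator with $[Tx,y]=[x,T^{\#}y]$ for all $x,y$. For a subspace $\mathcal S$, $\mathcal S^{[\perp]}=\{x\in\mathcal H:[x,s]=0\ \forall s\in\mathcal S\}$. $\mathcal S$ is nonnegative if $[s,s]\ge 0$ for all $s\in\mathcal S$. For $S,T\in L(\mathcal H)$, $S\le T$ means $[(T-S)x,x]\ge 0$ for all $x\in\mathcal H$. A closed subspace $\mathcal S$ is pseudo-regular if the algebraic sum $\mathcal S+\mathcal S^{[\perp]}$ is closed; it is known that this holds if and only if $\mathcal S$ is the range of a normal projection. $\mathcal Q_{\mathcal S}=\{Q\in L(\mathcal H): Q^2=Q,\ QQ^{\#}=Q^{\#}Q,\ R(Q)=\mathcal S\}$ is the set of normal projections onto $\mathcal S$. An operator $X_0\in L(\mathcal H)$ is an indefinite minimum solution (ImS) of $BX-C=0$ if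 $(BX_0-C)^{\#}(BX_0-C)\le (BX-C)^{\#}(BX-C)$ for every $X\in L(\mathcal H)$. *)

theory Defs
  imports "HOL-Analysis.Analysis" "HOL-Library.Complex_Order" "HOL-Library.Set_Algebras"
begin

text \<open>Inequalities between complex numbers are those of \<^theory>\<open>HOL-Library.Complex_Order\<close>:
  \<open>0 \<le> z\<close> means that \<open>z\<close> is real and nonnegative. Sums of sets are pointwise sums.\<close>

class complex_vector = ab_group_add +
  fixes scaleC :: "complex \<Rightarrow> 'a \<Rightarrow> 'a"  (infixr \<open>*\<^sub>C\<close> 75)
  assumes scaleC_add_right: "a *\<^sub>C (x + y) = a *\<^sub>C x + a *\<^sub>C y"
    and scaleC_add_left: "(a + b) *\<^sub>C x = a *\<^sub>C x + b *\<^sub>C x"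
    and scaleC_scaleC: "a *\<^sub>C (b *\<^sub>C x) = (a * b) *\<^sub>C x"
    and scaleC_one: "1 *\<^sub>C x = x"

text \<open>Class assumptions cannot mention constants that require a class, such as
  \<open>module.subspace\<close> or the sum of sets. The notions used to define Krein spaces are therefore
  stated elementarily in the class context.\<close>

context complex_vector
begin

definition csubspace :: "'a set \<Rightarrow> bool" where
  "csubspace S \<longleftrightarrow> 0 \<in> S \<and> (\<forall>x\<in>S. \<forall>y\<in>S. x + y \<in> S) \<and> (\<forall>c. \<forall>x\<in>S. c *\<^sub>C x \<in> S)"

text \<open>The modulus makes \<open>form_norm g\<close> the Hilbert space norm both of a positive definite form
  \<open>g\<close> and of the negative \<open>- g\<close> of a negative definite one.\<close>

definition form_norm :: "('a \<Rightarrow> 'a \<Rightarrow> complex) \<Rightarrow> 'a \<Rightarrow> real" where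
  "form_norm g x = sqrt (cmod (g x x))"

text \<open>Sesquilinearity and Hermitian symmetry of \<open>g\<close> are not repeated here, as they are part of
  the definition of a Krein space below.\<close>

definition separable_Hilbert_on ::
    "('a \<Rightarrow> 'a \<Rightarrow> complex) \<Rightarrow> 'a set \<Rightarrow> bool" where
  "separable_Hilbert_on g S \<longleftrightarrow>
     csubspace S \<and>
     (\<forall>x\<in>S. x \<noteq> 0 \<longrightarrow> 0 < g x x) \<and>
     Metric_space.mcomplete S (\<lambda>x y. form_norm g (x - y)) \<and>
     separable_space (Metric_space.mtopology S (\<lambda>x y. form_norm g (x - y)))"

definition fundamental_decomposition ::
    "('a \<Rightarrow> 'a \<Rightarrow> complex) \<Rightarrow> 'a set \<Rightarrow> 'a set \<Rightarrow> bool" where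
  "fundamental_decomposition g Hp Hm \<longleftrightarrow>
     Hp \<inter> Hm = {0} \<and> (\<forall>x. \<exists>p\<in>Hp. \<exists>m\<in>Hm. x = p + m) \<and>
     (\<forall>x\<in>Hp. \<forall>y\<in>Hm. g x y = 0) \<and>
     separable_Hilbert_on g Hp \<and>
     separable_Hilbert_on (\<lambda>x y. - g x y) Hm"

end

global_interpretation complex_vector:
  vector_space "scaleC :: complex \<Rightarrow> 'a \<Rightarrow> 'a::complex_vector"
  by unfold_locales
    (simp_all add: scaleC_add_right scaleC_add_left scaleC_scaleC scaleC_one)

lemma csubspace_iff_subspace: "csubspace S \<longleftrightarrow> complex_vector.subspace S"
  by (auto simp: csubspace_def complex_vector.subspace_def)

class krein_space = complex_vector +
  fixes kform :: "'a \<Rightarrow> 'a \<Rightarrow> complex"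
  assumes kform_add_left: "kform (x + y) z = kform x z + kform y z"
    and kform_scaleC_left: "kform (a *\<^sub>C x) y = a * kform x y"
    and kform_commute: "kform x y = cnj (kform y x)"
    and ex_fundamental_decomposition: "\<exists>Hp Hm. fundamental_decomposition kform Hp Hm"

definition fundamental_norm :: "'a::krein_space set \<Rightarrow> 'a set \<Rightarrow> 'a \<Rightarrow> real" where
  "fundamental_norm Hp Hm x =
     (let p = (THE p. p \<in> Hp \<and> x - p \<in> Hm)
      in sqrt ((form_norm kform p)\<^sup>2 + (form_norm kform (x - p))\<^sup>2))"

text \<open>All fundamental decompositions give equivalent norms, so bounded operators and the
  topology do not depend on
  which one is chosen.\<close>

definition krein_norm :: "'a::krein_space \<Rightarrow> real" where
  "krein_norm = (SOME \<nu>. \<exists>Hp Hm.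
     fundamental_decomposition kform Hp Hm \<and> \<nu> = fundamental_norm Hp Hm)"

definition krein_topology :: "'a::krein_space topology" where
  "krein_topology = Metric_space.mtopology UNIV (\<lambda>x y. krein_norm (x - y))"

definition bounded_ops :: "('a::krein_space \<Rightarrow> 'a) set"  (\<open>\<L>\<close>) where
  "\<L> = {T. Vector_Spaces.linear scaleC scaleC T \<and>
            (\<exists>K. \<forall>x. krein_norm (T x) \<le> K * krein_norm x)}"

definition closed_range_ops :: "('a::krein_space \<Rightarrow> 'a) set"  (\<open>\<C>\<R>\<close>) where
  "\<C>\<R> = {T \<in> \<L>. closedin krein_topology (range T)}"

definition null_space :: "('a::krein_space \<Rightarrow> 'a) \<Rightarrow> 'a set" where
  "null_space T = {x. T x = 0}"

definition kadjoint :: "('a::krein_space \<Rightarrow> 'a) \<Rightarrow> 'a \<Rightarrow> 'a"  (\<open>_\<^sup>#\<close> [1000] 1000) where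
  "T\<^sup># = (THE S. S \<in> \<L> \<and> (\<forall>x y. kform (T x) y = kform x (S y)))"

definition korth :: "'a::krein_space set \<Rightarrow> 'a set"  (\<open>_\<^sup>[\<^sup>\<bottom>\<^sup>]\<close> [1000] 1000) where
  "S\<^sup>[\<^sup>\<bottom>\<^sup>] = {x. \<forall>s\<in>S. kform x s = 0}"

definition nonnegative_subspace :: "'a::krein_space set \<Rightarrow> bool" where
  "nonnegative_subspace S \<longleftrightarrow> csubspace S \<and> (\<forall>s\<in>S. 0 \<le> kform s s)"

definition pseudo_regular :: "'a::krein_space set \<Rightarrow> bool" where
  "pseudo_regular S \<longleftrightarrow>
     csubspace S \<and> closedin krein_topology S \<and> closedin krein_topology (S + S\<^sup>[\<^sup>\<bottom>\<^sup>])"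

definition normal_projections :: "'a::krein_space set \<Rightarrow> ('a \<Rightarrow> 'a) set"  (\<open>\<Q>\<close>) where
  "\<Q> S = {Q \<in> \<L>. Q \<circ> Q = Q \<and> Q \<circ> Q\<^sup># = Q\<^sup># \<circ> Q \<and> range Q = S}"

definition op_le :: "('a::krein_space \<Rightarrow> 'a) \<Rightarrow> ('a \<Rightarrow> 'a) \<Rightarrow> bool"  (infix \<open>\<le>\<^sub>K\<close> 50) where
  "S \<le>\<^sub>K T \<longleftrightarrow> (\<forall>x. 0 \<le> kform (T x - S x) x)"

definition ImS :: "('a::krein_space \<Rightarrow> 'a) \<Rightarrow> ('a \<Rightarrow> 'a) \<Rightarrow> ('a \<Rightarrow> 'a) set" where
  "ImS B C = {X\<^sub>0 \<in> \<L>. \<forall>X\<in>\<L>.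
     (\<lambda>x. B (X\<^sub>0 x) - C x)\<^sup># \<circ> (\<lambda>x. B (X\<^sub>0 x) - C x)
       \<le>\<^sub>K (\<lambda>x. B (X x) - C x)\<^sup># \<circ> (\<lambda>x. B (X x) - C x)}"

end

theory Submission
  imports Defs
begin

text \<open>
  Since \<open>Q\<close> is a normal projection onto \<open>R(B)\<close>, the operators \<open>Q\<^sup>#Q\<close> and \<open>Q\<^sup>#\<close> agree on
  \<open>R(B) + R(B)\<^sup>[\<^sup>\<bottom>\<^sup>]\<close>, hence on \<open>R(C)\<close>. As \<open>B\<^sup>#Q\<^sup># = B\<^sup>#\<close>, this gives the normal equation
  \<open>B\<^sup>#(B X\<^sub>1 - C) = 0\<close>, and \<open>X\<^sub>1\<close> is an ImS because \<open>R(B)\<close> is nonnegative. By the Cauchy--Schwarz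
  inequality on \<open>R(B)\<close>, any other ImS is \<open>X\<^sub>1 + Z\<close> with \<open>R(Z) \<subseteq> N := N(B\<^sup>#B)\<close>. The normal
  projection \<open>E = D B'\<close> has kernel \<open>N\<close>, so \<open>E\<^sup>#\<close> maps \<open>N\<close> into itself and \<open>E\<close> maps \<open>N\<^sup>[\<^sup>\<bottom>\<^sup>]\<close>
  into itself. Hence \<open>R(X\<^sub>1) = R(D Q\<^sup># C)\<close> is orthogonal to \<open>N\<close>, and
  \<open>[X x, X x] = [X\<^sub>1 x, X\<^sub>1 x] + [Z x, Z x]\<close> with \<open>[Z x, Z x] \<ge> 0\<close>.
\<close>

section \<open>Semidefinite Hermitian forms: Cauchy-Schwarz and the associated seminorm\<close>

text \<open>Only nonnegativity is confined to \<open>S\<close>, so one locale covers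
  \<open>kform\<close> on subspaces and the inner product on the whole space. Neutral vectors are
  allowed because \<open>range B\<close> may contain them.\<close>

locale semidefinite_form =
  fixes h :: "'a::complex_vector \<Rightarrow> 'a \<Rightarrow> complex" and S :: "'a set"
  assumes subspace: "csubspace S"
    and add_left: "h (x + y) z = h x z + h y z"
    and scaleC_left: "h (a *\<^sub>C x) y = a * h x y"
    and commute: "h x y = cnj (h y x)"
    and nonneg: "x \<in> S \<Longrightarrow> 0 \<le> h x x"
begin

lemma add_right: "h x (y + z) = h x y + h x z"
  by (metis add_left commute complex_cnj_add)

lemma scaleC_right: "h x (a *\<^sub>C y) = cnj a * h x y"
  by (metis scaleC_left commute complex_cnj_mult)

lemma minus_left: "h (- x) y = - h x y"
  using scaleC_left[of "-1" x y] by simp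

lemma minus_right: "h x (- y) = - h x y"
  using scaleC_right[of x "-1" y] by simp

lemma diff_left: "h (x - y) z = h x z - h y z"
  using add_left[of x "-y" z] by (simp add: minus_left)

lemma diff_right: "h x (y - z) = h x y - h x z"
  using add_right[of x y "-z"] by (simp add: minus_right)

lemma zero_left [simp]: "h 0 x = 0"
  using diff_left[of 0 0 x] by simp

lemma zero_right [simp]: "h x 0 = 0"
  using diff_right[of x 0 0] by simp

lemma mem_add: "x \<in> S \<Longrightarrow> y \<in> S \<Longrightarrow> x + y \<in> S"
  and mem_scaleC: "x \<in> S \<Longrightarrow> c *\<^sub>C x \<in> S"
  using subspace by (auto simp: csubspace_def)

lemma mem_diff: "x \<in> S \<Longrightarrow> y \<in> S \<Longrightarrow> x - y \<in> S"
  using subspace by (simp add: csubspace_iff_subspace complex_vector.subspace_diff)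

lemma form_norm_square: "x \<in> S \<Longrightarrow> h x x = of_real ((form_norm h x)\<^sup>2)"
  using nonneg[of x] by (simp add: form_norm_def less_eq_complex_def complex_eq_iff cmod_def)

lemma form_norm_nonneg: "0 \<le> form_norm h x"
  by (simp add: form_norm_def)

lemma form_norm_scaleC: "form_norm h (c *\<^sub>C x) = cmod c * form_norm h x"
  by (simp add: form_norm_def scaleC_left scaleC_right norm_mult real_sqrt_mult
      flip: mult.assoc)

lemma form_norm_minus_commute: "form_norm h (x - y) = form_norm h (y - x)"
  using form_norm_scaleC[of "-1" "x - y"] by simp

lemma norm_add_square:
  assumes "x \<in> S" "y \<in> S"
  shows "(form_norm h (x + y))\<^sup>2 = (form_norm h x)\<^sup>2 + (form_norm h y)\<^sup>2 + 2 * Re (h x y)"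
proof -
  have "of_real ((form_norm h (x + y))\<^sup>2) = h (x + y) (x + y)"
    using assms by (simp add: form_norm_square mem_add)
  also have "\<dots> = h x x + h y y + (h x y + cnj (h x y))"
    using commute[of y x] by (simp add: add_left add_right)
  also have "\<dots> = of_real ((form_norm h x)\<^sup>2 + (form_norm h y)\<^sup>2 + 2 * Re (h x y))"
    using assms by (simp add: form_norm_square complex_add_cnj)
  finally show ?thesis
    by (simp only: of_real_eq_iff)
qed

text \<open>The form is nonnegative at \<open>x - t * h(x, y) y\<close> for every real
  \<open>t\<close>; a suitable \<open>t\<close> in the resulting quadratic inequality gives the
  bound.\<close>

lemma Cauchy_Schwarz:
  assumes "x \<in> S" "y \<in> S"
  shows "cmod (h x y) \<le> form_norm h x * form_norm h y"
proof -
  define a b k where "a = (form_norm h x)\<^sup>2" "b = (form_norm h y)\<^sup>2" "k = (cmod (h x y))\<^sup>2"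
  have pos: "0 \<le> a + t\<^sup>2 * (k * b) - 2 * t * k" for t
  proof -
    define c where "c = of_real (- t) * h x y"
    have "(form_norm h (x + c *\<^sub>C y))\<^sup>2
        = a + (form_norm h (c *\<^sub>C y))\<^sup>2 + 2 * Re (h x (c *\<^sub>C y))"
      by (simp only: norm_add_square[OF assms(1) mem_scaleC[OF assms(2)]] a_b_k_def)
    moreover have "(form_norm h (c *\<^sub>C y))\<^sup>2 = t\<^sup>2 * (k * b)"
      by (simp only: form_norm_scaleC a_b_k_def c_def) (simp add: norm_mult power_mult_distrib)
    moreover have "Re (h x (c *\<^sub>C y)) = - t * k"
      by (simp only: scaleC_right a_b_k_def c_def cmod_power2)
        (simp add: power2_eq_square algebra_simps)
    ultimately have "(form_norm h (x + c *\<^sub>C y))\<^sup>2 = a + t\<^sup>2 * (k * b) - 2 * t * k"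
      by simp
    then show ?thesis
      by (metis zero_le_power2)
  qed
  have nn: "0 \<le> a" "0 \<le> b" "0 \<le> k"
    by (auto simp: a_b_k_def)
  have "k \<le> a * b"
  proof (cases "b = 0")
    case True
    show ?thesis
    proof (rule ccontr)
      assume "\<not> k \<le> a * b"
      \<comment> \<open>With \<open>b = 0\<close> the inequality \<open>pos\<close> is affine in
        \<open>t\<close>; at \<open>t = (a + 1) / k\<close> its right side is
        \<open>- a - 2\<close>.\<close>
      then have "k > 0" using nn True by simp
      then have "((a + 1) / k) * k = a + 1" by simp
      then show False using pos[of "(a + 1) / k"] True nn \<open>k > 0\<close> by (simp add: mult.assoc)
    qed
  next
    case False
    \<comment> \<open>\<open>t = 1 / b\<close> minimises the quadratic and leaves
      \<open>0 \<le> a - k / b\<close>.\<close>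
    then have "b > 0" using nn by simp
    then show ?thesis using pos[of "1 / b"] by (simp add: field_simps power2_eq_square)
  qed
  then have "(cmod (h x y))\<^sup>2 \<le> (form_norm h x * form_norm h y)\<^sup>2"
    by (simp add: a_b_k_def power_mult_distrib)
  then show ?thesis
    by (rule power2_le_imp_le) (simp add: form_norm_nonneg)
qed

lemma form_norm_triangle:
  assumes "x \<in> S" "y \<in> S"
  shows "form_norm h (x + y) \<le> form_norm h x + form_norm h y"
proof -
  have "Re (h x y) \<le> form_norm h x * form_norm h y"
    using Cauchy_Schwarz[OF assms] complex_Re_le_cmod order_trans by blast
  then have "(form_norm h (x + y))\<^sup>2 \<le> (form_norm h x + form_norm h y)\<^sup>2"
    using assms by (simp add: norm_add_square power2_sum)
  then show ?thesis
    by (rule power2_le_imp_le) (simp add: form_norm_nonneg)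
qed

lemma form_norm_triangle_diff:
  assumes "x \<in> S" "y \<in> S" "z \<in> S"
  shows "form_norm h (x - z) \<le> form_norm h (x - y) + form_norm h (y - z)"
  using form_norm_triangle[of "x - y" "y - z"] assms by (simp add: mem_diff)

text \<open>Cauchy-Schwarz with a vanishing factor. On \<open>range B\<close> it places a neutral
  vector in the isotropic part.\<close>

lemma neutral_orthogonal:
  assumes "x \<in> S" "y \<in> S" "h x x = 0"
  shows "h x y = 0"
  using Cauchy_Schwarz[OF assms(1,2)] assms(3) by (simp add: form_norm_def)

end

section \<open>The inner product attached to a fundamental decomposition\<close>

lemma kform_zero_left [simp]: "kform 0 (x::'a::krein_space) = 0"
  using kform_add_left[of 0 0 x] by simp

text \<open>On the trivial subspace nonnegativity holds trivially, so the indefinite form inherits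
  the sesquilinear calculus.\<close>

interpretation kform: semidefinite_form "kform :: 'a::krein_space \<Rightarrow> 'a \<Rightarrow> complex" "{0}"
  by unfold_locales
    (simp_all add: csubspace_def kform_add_left kform_scaleC_left flip: kform_commute)

text \<open>\<open>krein_norm\<close> is chosen by \<open>SOME\<close>; the second assumption ties
  it to the decomposition at hand.\<close>

locale krein_decomposition =
  fixes Hp Hm :: "'a::krein_space set"
  assumes decomposition: "fundamental_decomposition kform Hp Hm"
    and krein_norm: "krein_norm = fundamental_norm Hp Hm"
begin

lemma subspace_Hp: "csubspace Hp" and subspace_Hm: "csubspace Hm"
  and positive: "x \<in> Hp \<Longrightarrow> x \<noteq> 0 \<Longrightarrow> 0 < kform x x"
  and negative: "x \<in> Hm \<Longrightarrow> x \<noteq> 0 \<Longrightarrow> 0 < - kform x x"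
  and orthogonal: "x \<in> Hp \<Longrightarrow> y \<in> Hm \<Longrightarrow> kform x y = 0"
  and mcomplete_Hp: "Metric_space.mcomplete Hp (\<lambda>x y. form_norm kform (x - y))"
  and mcomplete_Hm: "Metric_space.mcomplete Hm (\<lambda>x y. form_norm (\<lambda>x y. - kform x y) (x - y))"
  using decomposition unfolding fundamental_decomposition_def separable_Hilbert_on_def by auto

lemma orthogonal': "x \<in> Hp \<Longrightarrow> y \<in> Hm \<Longrightarrow> kform y x = 0"
  using orthogonal kform_commute[of y x] by simp

sublocale Hp: semidefinite_form kform Hp
  by unfold_locales (use subspace_Hp positive in
    \<open>force simp: kform_add_left kform_scaleC_left intro: kform_commute order_less_imp_le\<close>)+

sublocale Hm: semidefinite_form "\<lambda>x y. - kform x y" Hm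
proof unfold_locales
  show "- kform x y = cnj (- kform y x)" for x y :: 'a
    using kform_commute[of x y] by simp
  show "0 \<le> - kform x x" if "x \<in> Hm" for x
    using negative[OF that] by (cases "x = 0") (auto dest: order_less_imp_le)
qed (auto simp: subspace_Hm kform_add_left kform_scaleC_left)

text \<open>The projection onto \<open>Hp\<close> along \<open>Hm\<close>, by the same description
  as inside \<open>fundamental_norm\<close>.\<close>

definition P :: "'a \<Rightarrow> 'a" where
  "P x = (THE p. p \<in> Hp \<and> x - p \<in> Hm)"

lemma ex1: "\<exists>!p. p \<in> Hp \<and> x - p \<in> Hm"
proof -
  obtain p m where pm: "p \<in> Hp" "m \<in> Hm" "x = p + m"
    using decomposition unfolding fundamental_decomposition_def by metis
  have "q = p" if q: "q \<in> Hp" "x - q \<in> Hm" for q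
  proof -
    have "q - p \<in> Hp" using Hp.mem_diff pm q by blast
    moreover have "m - (x - q) \<in> Hm" using Hm.mem_diff pm q by blast
    then have "q - p \<in> Hm" using pm by simp
    ultimately show ?thesis
      using decomposition unfolding fundamental_decomposition_def
      by (metis IntI singletonD right_minus_eq)
  qed
  then show ?thesis using pm by (intro ex1I[of _ p]) auto
qed

lemma P_mem: "P x \<in> Hp" and co_P_mem: "x - P x \<in> Hm"
  using theI'[OF ex1[of x]] by (auto simp: P_def)

lemma P_eqI: "p \<in> Hp \<Longrightarrow> x - p \<in> Hm \<Longrightarrow> P x = p"
  using ex1[of x] P_mem co_P_mem by blast

lemma P_add: "P (x + y) = P x + P y"
proof (rule P_eqI)
  show "x + y - (P x + P y) \<in> Hm"
    using Hm.mem_add[OF co_P_mem co_P_mem, of x y] by (simp add: algebra_simps)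
qed (simp add: Hp.mem_add P_mem)

lemma P_scaleC: "P (c *\<^sub>C x) = c *\<^sub>C P x"
proof (rule P_eqI)
  show "c *\<^sub>C x - c *\<^sub>C P x \<in> Hm"
    using Hm.mem_scaleC[OF co_P_mem, of c x] by (simp add: complex_vector.scale_right_diff_distrib)
qed (simp add: Hp.mem_scaleC P_mem)

lemma P_diff: "P (x - y) = P x - P y"
  by (metis P_add add_diff_cancel diff_add_cancel)

lemma P_Hp: "x \<in> Hp \<Longrightarrow> P x = x"
  using subspace_Hm by (intro P_eqI) (auto simp: csubspace_def)

lemma P_Hm: "x \<in> Hm \<Longrightarrow> P x = 0"
  using subspace_Hp by (intro P_eqI) (auto simp: csubspace_def)

text \<open>The Hilbert inner product of the decomposition: the sign of the form is reversed on
  \<open>Hm\<close>.\<close>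

definition ip :: "'a \<Rightarrow> 'a \<Rightarrow> complex" where
  "ip x y = kform (P x) (P y) - kform (x - P x) (y - P y)"

text \<open>The fundamental symmetry of the decomposition.\<close>

definition J :: "'a \<Rightarrow> 'a" where
  "J x = P x - (x - P x)"

text \<open>The mixed terms vanish by orthogonality of \<open>Hp\<close> and \<open>Hm\<close>.
  Linearity of \<open>ip\<close> in its first argument and the passage from Riesz to the Krein form
  rest on this.\<close>

lemma ip_J: "ip x y = kform x (J y)"
proof -
  have "kform x (J y) = kform (P x + (x - P x)) (P y - (y - P y))"
    by (simp add: J_def)
  also have "\<dots> = ip x y"
    unfolding kform.add_left[of "P x" "x - P x"] kform.diff_right[of _ "P y" "y - P y"] ip_def
    by (simp only: orthogonal orthogonal' P_mem co_P_mem) simp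
  finally show ?thesis by simp
qed

lemma ip_nonneg: "0 \<le> ip x x"
  using Hp.nonneg[OF P_mem] Hm.nonneg[OF co_P_mem, of x] unfolding ip_def
  by (metis add_nonneg_nonneg diff_conv_add_uminus)

sublocale ip: semidefinite_form ip UNIV
proof unfold_locales
  show "ip x y = cnj (ip y x)" for x y
    unfolding ip_def by (subst (1 2) kform_commute) simp
  show "ip (x + y) z = ip x z + ip y z" for x y z
    by (simp add: ip_J kform_add_left)
  show "ip (c *\<^sub>C x) y = c * ip x y" for c x y
    by (simp add: ip_J kform_scaleC_left)
qed (simp_all add: csubspace_def ip_nonneg)

text \<open>Both parts of \<open>ip x x\<close> are nonnegative, so their moduli add up to its
  modulus.\<close>

lemma krein_norm_eq: "krein_norm x = form_norm ip x"
proof -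
  have "krein_norm x = sqrt (cmod (kform (P x) (P x)) + cmod (- kform (x - P x) (x - P x)))"
    by (simp add: krein_norm fundamental_norm_def P_def Let_def form_norm_def)
  also have "of_real (cmod (kform (P x) (P x)) + cmod (- kform (x - P x) (x - P x))) = ip x x"
    using Hp.nonneg[OF P_mem] Hm.nonneg[OF co_P_mem, of x]
    by (simp add: ip_def less_eq_complex_def complex_eq_iff cmod_def)
  then have "cmod (kform (P x) (P x)) + cmod (- kform (x - P x) (x - P x)) = cmod (ip x x)"
    by (metis abs_of_nonneg add_nonneg_nonneg norm_ge_zero norm_of_real)
  finally show ?thesis
    by (simp add: form_norm_def)
qed

lemma form_norm_Hp: "x \<in> Hp \<Longrightarrow> form_norm kform x = krein_norm x"
  by (simp add: krein_norm_eq form_norm_def ip_def P_Hp)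

lemma form_norm_Hm: "x \<in> Hm \<Longrightarrow> form_norm (\<lambda>x y. - kform x y) x = krein_norm x"
  by (simp add: krein_norm_eq form_norm_def ip_def P_Hm)

lemma krein_norm_square: "(krein_norm x)\<^sup>2 = (krein_norm (P x))\<^sup>2 + (krein_norm (x - P x))\<^sup>2"
proof -
  have "ip (P x) (x - P x) = 0"
    by (simp add: ip_def P_Hp P_Hm P_mem co_P_mem)
  then show ?thesis
    using ip.norm_add_square[of "P x" "x - P x"] by (simp add: krein_norm_eq)
qed

lemma krein_norm_eq_0: "krein_norm (x::'a) = 0 \<longleftrightarrow> x = 0"
proof
  assume "krein_norm x = 0"
  then have "krein_norm (P x) = 0" "krein_norm (x - P x) = 0"
    using krein_norm_square[of x] by (simp_all add: add_nonneg_eq_0_iff)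
  then have "kform (P x) (P x) = 0" "kform (x - P x) (x - P x) = 0"
    using form_norm_Hp[OF P_mem, of x] form_norm_Hm[OF co_P_mem, of x]
    by (simp_all add: form_norm_def)
  then have "P x = 0" "x - P x = 0"
    using positive[OF P_mem] negative[OF co_P_mem] by force+
  then show "x = 0" by simp
qed (simp add: krein_norm_eq form_norm_def)

section \<open>Completeness and Riesz representation\<close>

text \<open>Pythagoras makes both component maps contractions, so the components are Cauchy in
  \<open>Hp\<close> and \<open>Hm\<close>; the limits found there are added.\<close>

lemma complete:
  fixes s :: "nat \<Rightarrow> 'a"
  assumes cauchy: "\<And>e. e > 0 \<Longrightarrow> \<exists>N. \<forall>m\<ge>N. \<forall>n\<ge>N. krein_norm (s m - s n) < e"
  obtains l where "(\<lambda>n. krein_norm (s n - l)) \<longlonglongrightarrow> 0"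
proof -
  let ?dp = "\<lambda>x y. form_norm kform (x - y)"
  let ?dm = "\<lambda>x y. form_norm (\<lambda>x y. - kform x y) (x - y)"
  have dp: "?dp x y = krein_norm (x - y)" if "x \<in> Hp" "y \<in> Hp" for x y
    using that by (simp add: Hp.mem_diff form_norm_Hp)
  have dm: "?dm x y = krein_norm (x - y)" if "x \<in> Hm" "y \<in> Hm" for x y
    using that by (simp add: Hm.mem_diff form_norm_Hm)
  have p: "Metric_space Hp ?dp"
  proof unfold_locales
    show "?dp x y = 0 \<longleftrightarrow> x = y" if "x \<in> Hp" "y \<in> Hp" for x y
      using dp[OF that] krein_norm_eq_0[of "x - y"] by simp
  qed (auto simp: Hp.form_norm_nonneg Hp.form_norm_triangle_diff intro: Hp.form_norm_minus_commute)
  have m: "Metric_space Hm ?dm"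
  proof unfold_locales
    show "?dm x y = 0 \<longleftrightarrow> x = y" if "x \<in> Hm" "y \<in> Hm" for x y
      using dm[OF that] krein_norm_eq_0[of "x - y"] by simp
  qed (auto simp: Hm.form_norm_nonneg Hm.form_norm_triangle_diff intro: Hm.form_norm_minus_commute)
  have le: "krein_norm (P x) \<le> krein_norm x" "krein_norm (x - P x) \<le> krein_norm x" for x
  proof -
    have "(krein_norm (P x))\<^sup>2 \<le> (krein_norm x)\<^sup>2" "(krein_norm (x - P x))\<^sup>2 \<le> (krein_norm x)\<^sup>2"
      using krein_norm_square[of x] by simp_all
    then show "krein_norm (P x) \<le> krein_norm x" "krein_norm (x - P x) \<le> krein_norm x"
      by (simp_all add: power2_le_iff_abs_le krein_norm_eq ip.form_norm_nonneg)
  qed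
  have "Metric_space.MCauchy Hp ?dp (\<lambda>n. P (s n))"
    unfolding Metric_space.MCauchy_def[OF p]
  proof (intro conjI allI impI)
    fix e :: real assume "e > 0"
    then obtain N where N: "\<forall>m\<ge>N. \<forall>n\<ge>N. krein_norm (s m - s n) < e"
      using cauchy by blast
    have "?dp (P (s m)) (P (s n)) < e" if "N \<le> m" "N \<le> n" for m n
      using N that le(1)[of "s m - s n"] by (force simp: dp P_mem P_diff)
    then show "\<exists>N. \<forall>n n'. N \<le> n \<longrightarrow> N \<le> n' \<longrightarrow> ?dp (P (s n)) (P (s n')) < e"
      by blast
  qed (auto simp: P_mem)
  then obtain a where "limitin (Metric_space.mtopology Hp ?dp) (\<lambda>n. P (s n)) a sequentially"
    using mcomplete_Hp unfolding Metric_space.mcomplete_def[OF p] by blast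
  then have a: "a \<in> Hp" "\<forall>e>0. \<exists>N. \<forall>n\<ge>N. ?dp (P (s n)) a < e"
    unfolding Metric_space.limit_metric_sequentially[OF p] by blast+
  have "Metric_space.MCauchy Hm ?dm (\<lambda>n. s n - P (s n))"
    unfolding Metric_space.MCauchy_def[OF m]
  proof (intro conjI allI impI)
    fix e :: real assume "e > 0"
    then obtain N where N: "\<forall>m\<ge>N. \<forall>n\<ge>N. krein_norm (s m - s n) < e"
      using cauchy by blast
    have "?dm (s m - P (s m)) (s n - P (s n)) < e" if "N \<le> m" "N \<le> n" for m n
    proof -
      have "?dm (s m - P (s m)) (s n - P (s n)) = krein_norm (s m - s n - P (s m - s n))"
        by (subst dm) (auto simp: co_P_mem P_diff algebra_simps)
      then show ?thesis using N that le(2)[of "s m - s n"] by force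
    qed
    then show "\<exists>N. \<forall>n n'. N \<le> n \<longrightarrow> N \<le> n' \<longrightarrow> ?dm (s n - P (s n)) (s n' - P (s n')) < e"
      by blast
  qed (auto simp: co_P_mem)
  then obtain b where "limitin (Metric_space.mtopology Hm ?dm) (\<lambda>n. s n - P (s n)) b sequentially"
    using mcomplete_Hm unfolding Metric_space.mcomplete_def[OF m] by blast
  then have b: "b \<in> Hm" "\<forall>e>0. \<exists>N. \<forall>n\<ge>N. ?dm (s n - P (s n)) b < e"
    unfolding Metric_space.limit_metric_sequentially[OF m] by blast+
  have "(\<lambda>n. krein_norm (P (s n) - a)) \<longlonglongrightarrow> 0" "(\<lambda>n. krein_norm (s n - P (s n) - b)) \<longlonglongrightarrow> 0"
    using a b by (auto simp: LIMSEQ_iff dp dm P_mem co_P_mem krein_norm_eq ip.form_norm_nonneg)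
  then have lim: "(\<lambda>n. krein_norm (P (s n) - a) + krein_norm (s n - P (s n) - b)) \<longlonglongrightarrow> 0"
    using tendsto_add by fastforce
  have "krein_norm (s n - (a + b)) \<le> krein_norm (P (s n) - a) + krein_norm (s n - P (s n) - b)" for n
    using ip.form_norm_triangle[of "P (s n) - a" "s n - P (s n) - b"]
    by (simp add: krein_norm_eq algebra_simps)
  then have "(\<lambda>n. krein_norm (s n - (a + b))) \<longlonglongrightarrow> 0"
    by (intro tendsto_sandwich[OF _ _ tendsto_const lim])
      (auto simp: krein_norm_eq ip.form_norm_nonneg)
  then show ?thesis by (rule that)
qed

text \<open>The representing vector minimises \<open>\<parallel>x\<parallel>\<^sup>2 - 2 Re (f x)\<close>; by the parallelogram law
  every minimising sequence is Cauchy.\<close>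

lemma Riesz:
  assumes f_add: "\<And>x y. f (x + y) = f x + f y" and f_scaleC: "\<And>c x. f (c *\<^sub>C x) = c * f x"
    and f_le: "\<And>x. cmod (f x) \<le> K * krein_norm x"
  obtains z where "\<And>x. f x = ip x z"
proof -
  define F where "F x = (krein_norm x)\<^sup>2 - 2 * Re (f x)" for x
  \<comment> \<open>Completing the square in \<open>krein_norm x\<close> bounds \<open>F\<close>
    below.\<close>
  have bound: "- K\<^sup>2 \<le> F x" for x
  proof -
    have "Re (f x) \<le> K * krein_norm x"
      using f_le complex_Re_le_cmod order_trans by blast
    moreover have "0 \<le> (krein_norm x - K)\<^sup>2" by simp
    ultimately show ?thesis by (simp add: F_def power2_diff mult.commute)
  qed
  define i where "i = Inf (range F)"
  have i_le: "i \<le> F x" for x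
    unfolding i_def using bound by (intro cINF_lower bdd_belowI2) auto
  have "\<exists>x. F x < i + 1 / Suc n" for n
    using cInf_lessD[of "range F" "i + 1 / Suc n"] by (force simp: i_def)
  then obtain s where s: "\<And>n. F (s n) < i + 1 / Suc n" by metis
  have F_add: "F (x + y) = F x + (krein_norm y)\<^sup>2 + 2 * Re (ip x y) - 2 * Re (f y)" for x y
    using ip.norm_add_square[of x y] by (simp add: F_def krein_norm_eq f_add)
  have mid: "(krein_norm (x - y))\<^sup>2 \<le> 2 * F x + 2 * F y - 4 * i" for x y
  proof -
    \<comment> \<open>Half difference and midpoint: \<open>x = w + u\<close> and
      \<open>y = w - u\<close>, so the terms linear in \<open>u\<close> cancel in
      \<open>F x + F y\<close>.\<close>
    define u where "u = (1/2 :: complex) *\<^sub>C (x - y)"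
    define w where "w = (1/2 :: complex) *\<^sub>C (x + y)"
    have "w + u = ((1/2 :: complex) + 1/2) *\<^sub>C x"
      unfolding u_def w_def scaleC_add_left
      by (simp add: complex_vector.scale_right_distrib complex_vector.scale_right_diff_distrib)
    then have x: "x = w + u" by simp
    have "w - u = ((1/2 :: complex) + 1/2) *\<^sub>C y"
      unfolding u_def w_def scaleC_add_left
      by (simp add: complex_vector.scale_right_distrib complex_vector.scale_right_diff_distrib)
    then have y: "y = w + - u" by simp
    have n: "krein_norm (x - y) = 2 * krein_norm u" "krein_norm (- u) = krein_norm u"
      using ip.form_norm_scaleC[of "1/2" "x - y"] ip.form_norm_scaleC[of "-1" u]
      by (simp_all add: krein_norm_eq u_def)
    have "f (- u) = - f u" using f_scaleC[of "-1" u] by simp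
    then have "F x + F y = 2 * F w + 2 * (krein_norm u)\<^sup>2"
      unfolding x y F_add[of w] by (simp add: n ip.minus_right)
    then show ?thesis using i_le[of w] n(1) by (simp add: power_mult_distrib)
  qed
  have "\<exists>N. \<forall>m\<ge>N. \<forall>n\<ge>N. krein_norm (s m - s n) < e" if "e > 0" for e
  proof -
    \<comment> \<open>\<open>mid\<close> and the choice of \<open>s\<close> bound the squared
      distance by \<open>2 / (m + 1) + 2 / (n + 1)\<close>.\<close>
    have "0 < e\<^sup>2 / 4" using that by simp
    then obtain N :: nat where N: "1 / Suc N < e\<^sup>2 / 4"
      using reals_Archimedean by (metis inverse_eq_divide)
    have "krein_norm (s m - s n) < e" if mn: "N \<le> m" "N \<le> n" for m n
    proof -
      have "1 / real (Suc m) \<le> 1 / Suc N" "1 / real (Suc n) \<le> 1 / Suc N"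
        using mn by (auto simp: field_simps)
      then have "(krein_norm (s m - s n))\<^sup>2 < e\<^sup>2"
        using mid[of "s m" "s n"] s[of m] s[of n] N by linarith
      then show ?thesis by (rule power2_less_imp_less) (use \<open>e > 0\<close> in simp)
    qed
    then show ?thesis by blast
  qed
  then obtain z where z: "(\<lambda>n. krein_norm (s n - z)) \<longlonglongrightarrow> 0"
    using complete[of s] by blast
  have ip_lim: "(\<lambda>n. ip (s n) y) \<longlonglongrightarrow> ip z y" for y
  proof -
    have "cmod (ip (s n) y - ip z y) \<le> krein_norm (s n - z) * krein_norm y" for n
      using ip.Cauchy_Schwarz[of "s n - z" y] by (simp add: ip.diff_left krein_norm_eq)
    then have "(\<lambda>n. ip (s n) y - ip z y) \<longlonglongrightarrow> 0"
      by (intro Lim_null_comparison[OF always_eventually tendsto_mult_left_zero[OF z]]) auto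
    then show ?thesis by (simp add: LIM_zero_iff)
  qed
  have Re_eq: "Re (f y) = Re (ip z y)" for y
  proof -
    define d where "d = Re (ip z y) - Re (f y)"
    \<comment> \<open>First variation: \<open>i\<close> is at most \<open>F\<close> at
      \<open>s n + t y\<close>, while \<open>F (s n) < i + 1 / (n + 1)\<close>; the limit in
      \<open>n\<close> removes the error term.\<close>
    have quad: "0 \<le> t\<^sup>2 * (krein_norm y)\<^sup>2 + 2 * t * d" for t
    proof (rule LIMSEQ_le[where X = "\<lambda>n. - (1 / real (Suc n))" and x = 0])
      show "(\<lambda>n. - (1 / real (Suc n))) \<longlonglongrightarrow> 0"
        using tendsto_minus[OF LIMSEQ_inverse_real_of_nat] by (simp add: inverse_eq_divide)
      show "(\<lambda>n. t\<^sup>2 * (krein_norm y)\<^sup>2 + 2 * t * (Re (ip (s n) y) - Re (f y)))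
          \<longlonglongrightarrow> t\<^sup>2 * (krein_norm y)\<^sup>2 + 2 * t * d"
        unfolding d_def by (intro tendsto_intros ip_lim)
      have "- (1 / real (Suc n)) \<le> t\<^sup>2 * (krein_norm y)\<^sup>2 + 2 * t * (Re (ip (s n) y) - Re (f y))" for n
      proof -
        have "F (s n + of_real t *\<^sub>C y) = F (s n) + (t\<^sup>2 * (krein_norm y)\<^sup>2
            + 2 * t * (Re (ip (s n) y) - Re (f y)))"
          by (simp add: F_add krein_norm_eq ip.form_norm_scaleC f_scaleC ip.scaleC_right
              power_mult_distrib algebra_simps)
        then show ?thesis
          using i_le[of "s n + of_real t *\<^sub>C y"] s[of n] by linarith
      qed
      then show "\<exists>N. \<forall>n\<ge>N. - (1 / real (Suc n))
          \<le> t\<^sup>2 * (krein_norm y)\<^sup>2 + 2 * t * (Re (ip (s n) y) - Re (f y))" by blast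
    qed
    \<comment> \<open>Adding 1 keeps \<open>c\<close> positive even for \<open>y = 0\<close>. At
      \<open>t = - d / c\<close> the quadratic is bounded by a negative multiple of the square of
      \<open>d\<close>.\<close>
    define c where "c = (krein_norm y)\<^sup>2 + 1"
    have "c > 0" by (simp add: c_def add_nonneg_pos)
    have "0 \<le> (d / c)\<^sup>2 * (c - 1) - 2 * (d / c) * d"
      using quad[of "- d / c"] by (simp add: c_def)
    also have "\<dots> = - (d\<^sup>2 * (c + 1)) / c\<^sup>2"
      using \<open>c > 0\<close> by (simp add: field_simps power2_eq_square)
    finally have "d = 0"
      using \<open>c > 0\<close> by (simp add: divide_le_0_iff mult_le_0_iff)
    then show ?thesis by (simp add: d_def)
  qed
  have "f y = ip y z" for y
  proof (rule complex_eqI)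
    show "Re (f y) = Re (ip y z)"
      using Re_eq[of y] ip.commute[of y z] by simp
    \<comment> \<open>Real parts at \<open>\<i> *\<^sub>C y\<close> are minus the imaginary parts at
      \<open>y\<close>.\<close>
    show "Im (f y) = Im (ip y z)"
      using Re_eq[of "\<i> *\<^sub>C y"] ip.commute[of y z] by (simp add: f_scaleC ip.scaleC_right)
  qed
  then show ?thesis by (rule that)
qed


section \<open>The fundamental symmetry: bounds and representation for the Krein form\<close>

lemma krein_norm_J: "krein_norm (J x) = krein_norm x"
proof -
  have "J x = P x + (-1) *\<^sub>C (x - P x)"
    by (simp add: J_def)
  then have P: "P (J x) = P x" "J x - P x = - (x - P x)"
    by (simp_all only: P_add P_scaleC P_Hp P_Hm P_mem co_P_mem) simp_all
  show ?thesis
    by (simp only: krein_norm_eq form_norm_def ip_def P kform.minus_left kform.minus_right minus_minus)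
qed

text \<open>Cauchy-Schwarz for \<open>ip\<close>, transported by \<open>J\<close>, which is an
  involution and an isometry.\<close>

lemma kform_le: "cmod (kform x (y::'a)) \<le> krein_norm x * krein_norm y"
proof -
  have "J (J y) = y"
  proof -
    have "P (J y) = P y - P (y - P y)" by (simp add: J_def P_diff P_Hp P_mem)
    then have "P (J y) = P y" by (simp add: P_Hm co_P_mem P_Hp P_mem)
    then show ?thesis by (simp add: J_def)
  qed
  then have "kform x y = ip x (J y)" by (simp add: ip_J)
  then show ?thesis
    using ip.Cauchy_Schwarz[of x "J y"] krein_norm_J[of y] by (simp add: krein_norm_eq)
qed

text \<open>Used to test vectors against \<open>J\<close>: nondegeneracy of the form and the bound
  on adjoints follow from it.\<close>

lemma kform_J_self: "kform x (J x) = of_real ((krein_norm x)\<^sup>2)"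
  using ip.form_norm_square[of x] by (simp add: ip_J krein_norm_eq)

lemma kform_representation:
  fixes f :: "'a \<Rightarrow> complex"
  assumes "\<And>x y. f (x + y) = f x + f y" "\<And>c x. f (c *\<^sub>C x) = c * f x"
    and "\<And>x. cmod (f x) \<le> K * krein_norm x"
  obtains z where "\<And>x. f x = kform x z"
  using Riesz[of f K] assms ip_J by metis

end

section \<open>Norm and form without reference to a decomposition\<close>

lemma ex_krein_decomposition: "\<exists>Hp Hm :: 'a::krein_space set. krein_decomposition Hp Hm"
proof -
  have "\<exists>\<nu>. \<exists>Hp Hm :: 'a set. fundamental_decomposition kform Hp Hm \<and> \<nu> = fundamental_norm Hp Hm"
    using ex_fundamental_decomposition by blast
  from someI_ex[OF this, folded krein_norm_def] show ?thesis
    by (auto simp: krein_decomposition_def)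
qed

lemma krein_norm_nonneg: "0 \<le> krein_norm (x::'a::krein_space)"
  and krein_norm_triangle: "krein_norm (x + y) \<le> krein_norm x + krein_norm (y::'a)"
  and krein_norm_scaleC: "krein_norm (c *\<^sub>C x) = cmod c * krein_norm x"
  and kform_le: "cmod (kform x y) \<le> krein_norm x * krein_norm y"
  and Metric_space_krein_norm: "Metric_space (UNIV::'a set) (\<lambda>x y. krein_norm (x - y))"
proof -
  obtain Hp Hm :: "'a set" where "krein_decomposition Hp Hm"
    using ex_krein_decomposition by blast
  then interpret krein_decomposition Hp Hm .
  show nonneg: "0 \<le> krein_norm x" for x :: 'a
    by (simp add: krein_norm_eq ip.form_norm_nonneg)
  show "krein_norm (x + y) \<le> krein_norm x + krein_norm y"
    by (simp add: krein_norm_eq ip.form_norm_triangle)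
  show "krein_norm (c *\<^sub>C x) = cmod c * krein_norm x"
    by (simp add: krein_norm_eq ip.form_norm_scaleC)
  have eq_0: "krein_norm x = 0 \<longleftrightarrow> x = 0" for x :: 'a
    by (rule krein_norm_eq_0)
  show "cmod (kform x y) \<le> krein_norm x * krein_norm y"
    by (rule kform_le)
  show "Metric_space (UNIV::'a set) (\<lambda>x y. krein_norm (x - y))"
    by unfold_locales (simp_all add: nonneg eq_0,
      simp_all add: krein_norm_eq ip.form_norm_triangle_diff ip.form_norm_minus_commute)
qed

text \<open>A vector orthogonal to everything is orthogonal to its own image under \<open>J\<close>,
  hence has norm 0.\<close>

lemma kform_nondegenerate:
  assumes "\<And>x. kform x y = kform x (z::'a::krein_space)"
  shows "y = z"
proof -
  obtain Hp Hm :: "'a set" where "krein_decomposition Hp Hm"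
    using ex_krein_decomposition by blast
  then interpret krein_decomposition Hp Hm .
  have "kform (y - z) (J (y - z)) = cnj (kform (J (y - z)) (y - z))"
    by (rule kform_commute)
  also have "\<dots> = 0"
    using assms by (simp add: kform.diff_right)
  finally show ?thesis
    by (simp add: kform_J_self krein_norm_eq_0)
qed

lemma kform_eq_0_commute: "kform x y = 0 \<longleftrightarrow> kform y (x::'a::krein_space) = 0"
  by (subst kform_commute) simp

lemma kform_nondegenerate_left:
  assumes "\<And>x. kform y x = kform (z::'a::krein_space) x"
  shows "y = z"
proof (rule kform_nondegenerate)
  show "kform x y = kform x z" for x
    using assms[of x] by (simp add: kform_commute[of x y] kform_commute[of x z])
qed

section \<open>Bounded operators and their adjoints\<close>

lemma bounded_ops_iff:
  "T \<in> \<L> \<longleftrightarrow> (\<forall>x y. T (x + y) = T x + T y) \<and> (\<forall>c x. T (c *\<^sub>C x) = c *\<^sub>C T x)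
     \<and> (\<exists>K\<ge>0. \<forall>x. krein_norm (T x) \<le> K * krein_norm (x::'a::krein_space))"
proof -
  have "(\<exists>K. \<forall>x. krein_norm (T x) \<le> K * krein_norm x)
      \<longleftrightarrow> (\<exists>K\<ge>0. \<forall>x. krein_norm (T x) \<le> K * krein_norm x)"
  proof (intro iffI; elim exE)
    fix K assume K: "\<forall>x. krein_norm (T x) \<le> K * krein_norm x"
    have "krein_norm (T x) \<le> \<bar>K\<bar> * krein_norm x" for x
      using K[rule_format, of x] mult_right_mono[OF abs_ge_self krein_norm_nonneg, of K x] by linarith
    then show "\<exists>K\<ge>0. \<forall>x. krein_norm (T x) \<le> K * krein_norm x"
      by (intro exI[of _ "\<bar>K\<bar>"]) auto
  qed auto
  moreover have "Vector_Spaces.linear scaleC scaleC T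
      \<longleftrightarrow> (\<forall>x y. T (x + y) = T x + T y) \<and> (\<forall>c x. T (c *\<^sub>C x) = c *\<^sub>C T x)"
    using complex_vector.vector_space_axioms complex_vector.module_axioms
    by (auto simp: linear_iff_module_hom module_hom_iff)
  ultimately show ?thesis
    by (simp add: bounded_ops_def)
qed

lemma bounded_opsE:
  assumes "T \<in> \<L>"
  obtains K where "K \<ge> 0" "\<And>x. krein_norm (T x) \<le> K * krein_norm x"
  using assms bounded_ops_iff by blast

lemma bounded_ops_add: "T \<in> \<L> \<Longrightarrow> T (x + y) = T x + T y"
  and bounded_ops_scaleC: "T \<in> \<L> \<Longrightarrow> T (c *\<^sub>C x) = c *\<^sub>C T x"
  by (simp_all add: bounded_ops_iff)

lemma bounded_ops_diff: "T \<in> \<L> \<Longrightarrow> T (x - y) = T x - T y"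
  by (metis bounded_ops_add add_diff_cancel diff_add_cancel)

lemma bounded_ops_zero: "T \<in> \<L> \<Longrightarrow> T 0 = 0"
  using bounded_ops_diff[of T 0 0] by simp

lemma bounded_ops_comp:
  assumes "S \<in> \<L>" "T \<in> \<L>"
  shows "S \<circ> T \<in> \<L>"
proof -
  obtain K where K: "K \<ge> 0" "\<And>x. krein_norm (S x) \<le> K * krein_norm x"
    using assms(1) by (rule bounded_opsE) blast
  obtain M where M: "M \<ge> 0" "\<And>x. krein_norm (T x) \<le> M * krein_norm x"
    using assms(2) by (rule bounded_opsE) blast
  have "krein_norm (S (T x)) \<le> (K * M) * krein_norm x" for x
    using K(2)[of "T x"] mult_left_mono[OF M(2) K(1), of x] by (simp add: mult.assoc)
  then show ?thesis
    using assms K(1) M(1) mult_nonneg_nonneg unfolding bounded_ops_iff[of "S \<circ> T"]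
    by (auto simp: bounded_ops_add bounded_ops_scaleC)
qed

lemma bounded_ops_fun_diff:
  assumes "S \<in> \<L>" "T \<in> \<L>"
  shows "(\<lambda>x. S x - T x) \<in> \<L>"
proof -
  obtain K where K: "K \<ge> 0" "\<And>x. krein_norm (S x) \<le> K * krein_norm x"
    using assms(1) by (rule bounded_opsE) blast
  obtain M where M: "M \<ge> 0" "\<And>x. krein_norm (T x) \<le> M * krein_norm x"
    using assms(2) by (rule bounded_opsE) blast
  have "krein_norm (S x - T x) \<le> (K + M) * krein_norm x" for x
    using krein_norm_triangle[of "S x" "(-1) *\<^sub>C T x"] krein_norm_scaleC[of "-1" "T x"] K(2)[of x] M(2)[of x]
    by (simp add: algebra_simps)
  then show ?thesis
    using assms K(1) M(1) add_nonneg_nonneg unfolding bounded_ops_iff[of "\<lambda>x. S x - T x"]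
    by (auto simp: bounded_ops_add bounded_ops_scaleC complex_vector.scale_right_diff_distrib)
qed

text \<open>For fixed \<open>y\<close> the functional \<open>x \<mapsto> kform (T x) y\<close> is
  bounded, so a vector \<open>S y\<close> represents it; nondegeneracy makes \<open>S\<close>
  linear.\<close>

lemma ex_kadjoint:
  fixes T :: "'a::krein_space \<Rightarrow> 'a"
  assumes T: "T \<in> \<L>"
  shows "\<exists>S\<in>\<L>. \<forall>x y. kform (T x) y = kform x (S y)"
proof -
  obtain Hp Hm :: "'a set" where "krein_decomposition Hp Hm"
    using ex_krein_decomposition by blast
  then interpret krein_decomposition Hp Hm .
  obtain K where K: "K \<ge> 0" "\<And>x. krein_norm (T x) \<le> K * krein_norm x"
    using T by (rule bounded_opsE) blast
  have le: "cmod (kform (T x) y) \<le> (K * krein_norm y) * krein_norm x" for x y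
    using kform_le[of "T x" y] mult_right_mono[OF K(2) krein_norm_nonneg, of x y]
    by (simp add: algebra_simps)
  have "\<exists>z. \<forall>x. kform (T x) y = kform x z" for y
    by (rule kform_representation[where f = "\<lambda>x. kform (T x) y", OF _ _ le])
      (auto simp: T bounded_ops_add bounded_ops_scaleC kform_add_left kform_scaleC_left)
  then obtain S where S: "\<And>x y. kform (T x) y = kform x (S y)"
    by metis
  have add: "S (x + y) = S x + S y" for x y
    by (rule kform_nondegenerate) (simp add: kform.add_right flip: S)
  have scaleC: "S (c *\<^sub>C x) = c *\<^sub>C S x" for c x
    by (rule kform_nondegenerate) (simp add: kform.scaleC_right flip: S)
  \<comment> \<open>Testing against \<open>J (S y)\<close> bounds the squared norm of
    \<open>S y\<close> by \<open>K * krein_norm y * krein_norm (S y)\<close>, and one factor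
    cancels.\<close>
  have "krein_norm (S y) \<le> K * krein_norm y" for y
  proof -
    have "(krein_norm (S y))\<^sup>2 = cmod (kform (S y) (J (S y)))"
      by (simp add: kform_J_self norm_power)
    also have "\<dots> = cmod (kform (J (S y)) (S y))"
      by (metis kform_commute complex_mod_cnj)
    also have "\<dots> \<le> K * krein_norm y * krein_norm (S y)"
      using le[of "J (S y)" y] by (simp add: S krein_norm_J)
    finally show ?thesis
      using krein_norm_nonneg[of "S y"] mult_nonneg_nonneg[OF K(1) krein_norm_nonneg[of y]]
      by (cases "krein_norm (S y) = 0") (auto simp: power2_eq_square)
  qed
  then have "S \<in> \<L>"
    using add scaleC K(1) by (auto simp: bounded_ops_iff)
  then show ?thesis using S by blast
qed

text \<open>Nondegeneracy makes the adjoint unique, so the description in \<open>kadjoint\<close>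
  denotes the operator from \<open>ex_kadjoint\<close>.\<close>

lemma
  assumes "T \<in> \<L>"
  shows kadjoint_bounded: "T\<^sup># \<in> \<L>"
    and kadjoint_right: "kform (T x) y = kform x (T\<^sup># y)"
proof -
  have "\<exists>!S. S \<in> \<L> \<and> (\<forall>x y. kform (T x) y = kform x (S y))"
    using ex_kadjoint[OF assms] by (metis kform_nondegenerate ext)
  from theI'[OF this, folded kadjoint_def]
  show "T\<^sup># \<in> \<L>" "kform (T x) y = kform x (T\<^sup># y)" by blast+
qed

lemma kadjoint_left: "T \<in> \<L> \<Longrightarrow> kform (T\<^sup># x) y = kform x (T y)"
  using kform_commute[of "T\<^sup># x" y] kform_commute[of x "T y"] by (simp add: kadjoint_right)

section \<open>The operator order made pointwise, and passage to closures\<close>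

text \<open>Moving the adjoint across turns \<open>kform (S\<^sup># (S x)) x\<close> into
  \<open>kform (S x) (S x)\<close>.\<close>

lemma op_le_kadjoint_comp:
  assumes "S \<in> \<L>" "T \<in> \<L>"
  shows "S\<^sup># \<circ> S \<le>\<^sub>K T\<^sup># \<circ> T \<longleftrightarrow> (\<forall>x. kform (S x) (S x) \<le> kform (T x) (T x))"
  by (simp add: op_le_def kform.diff_left kadjoint_left assms)

lemma ImS_iff:
  assumes "B \<in> \<L>" "C \<in> \<L>"
  shows "X\<^sub>0 \<in> ImS B C \<longleftrightarrow> X\<^sub>0 \<in> \<L> \<and> (\<forall>X\<in>\<L>. \<forall>x.
    kform (B (X\<^sub>0 x) - C x) (B (X\<^sub>0 x) - C x) \<le> kform (B (X x) - C x) (B (X x) - C x))"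
proof -
  have "(\<lambda>x. B (X x) - C x) \<in> \<L>" if "X \<in> \<L>" for X
    using bounded_ops_fun_diff[OF bounded_ops_comp[OF assms(1) that] assms(2)] by simp
  then show ?thesis
    by (auto simp: ImS_def op_le_kadjoint_comp)
qed

text \<open>The functional \<open>a \<mapsto> kform (T a) w\<close> is continuous, so its zero set
  is closed. It serves for \<open>T\<close> equal to \<open>Q\<^sup>#Q - Q\<^sup>#\<close> and to
  \<open>D \<circ> Q\<^sup>#\<close>.\<close>

lemma closure_of_orthogonal:
  assumes "x \<in> krein_topology closure_of A" and T: "T \<in> \<L>"
    and zero: "\<And>a. a \<in> A \<Longrightarrow> kform (T a) w = 0"
  shows "kform (T x) w = 0"
proof (rule ccontr)
  assume "kform (T x) w \<noteq> 0"
  obtain K where K: "K \<ge> 0" "\<And>x. krein_norm (T x) \<le> K * krein_norm x"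
    using T by (rule bounded_opsE) blast
  \<comment> \<open>\<open>c\<close> bounds the functional; the summand 1 permits division also when
    \<open>K * krein_norm w\<close> is 0.\<close>
  define c where "c = K * krein_norm w + 1"
  have "c > 0" using K(1) krein_norm_nonneg[of w] by (simp add: c_def add_nonneg_pos)
  define e where "e = cmod (kform (T x) w) / c"
  have "e > 0" using \<open>c > 0\<close> \<open>kform (T x) w \<noteq> 0\<close> by (simp add: e_def)
  then obtain a where a: "a \<in> A" "krein_norm (x - a) < e"
    using assms(1) unfolding krein_topology_def
      Metric_space.metric_closure_of[OF Metric_space_krein_norm] Metric_space.in_mball[OF Metric_space_krein_norm]
    by auto
  have "cmod (kform (T x) w) = cmod (kform (T (x - a)) w)"
    using zero[OF a(1)] T by (simp add: bounded_ops_diff kform.diff_left)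
  also have "\<dots> \<le> krein_norm (T (x - a)) * krein_norm w"
    by (rule kform_le)
  also have "\<dots> \<le> K * krein_norm (x - a) * krein_norm w"
    by (intro mult_right_mono K krein_norm_nonneg)
  also have "\<dots> \<le> c * krein_norm (x - a)"
    using krein_norm_nonneg[of "x - a"] by (simp add: c_def algebra_simps)
  also have "\<dots> < c * e"
    using a(2) \<open>c > 0\<close> by simp
  also have "\<dots> = cmod (kform (T x) w)"
    using \<open>c > 0\<close> by (simp add: e_def)
  finally show False by simp
qed

lemma kform_add_square:
  assumes "kform x y = 0"
  shows "kform (x + y) (x + y) = kform x x + kform y y"
proof -
  have "kform y x = 0" using assms by (simp only: kform_eq_0_commute[of y])
  then show ?thesis using assms by (simp add: kform_add_left kform.add_right)
qed

section \<open>Normal equation and minimality of \<open>X\<^sub>1\<close>\<close>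

theorem theorem6p8:
  fixes B C Q B' D X\<^sub>1 :: "'a::krein_space \<Rightarrow> 'a"
  assumes "B \<in> \<C>\<R>" and "C \<in> \<L>"
    and "nonnegative_subspace (range B)" and "pseudo_regular (range B)"
    and "nonnegative_subspace (null_space (B\<^sup># \<circ> B))"
    and "pseudo_regular (null_space (B\<^sup># \<circ> B))"
    and "range C \<subseteq> krein_topology closure_of (B ` ((null_space (B\<^sup># \<circ> B))\<^sup>[\<^sup>\<bottom>\<^sup>]) + (range B)\<^sup>[\<^sup>\<bottom>\<^sup>])"
    and "Q \<in> \<Q> (range B)"
    and "B' = Q\<^sup># \<circ> B"
    and "D \<in> \<L>"
    and "B' \<circ> D \<circ> B' = B'" and "D \<circ> B' \<circ> D = D"
    and "B' \<circ> D = Q\<^sup># \<circ> Q"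
    and "(D \<circ> B')\<^sup># \<circ> (D \<circ> B') = (D \<circ> B') \<circ> (D \<circ> B')\<^sup>#"
    and "X\<^sub>1 = D \<circ> C"
  shows "X\<^sub>1 \<in> ImS B C \<and> (\<forall>X\<in>ImS B C. X\<^sub>1\<^sup># \<circ> X\<^sub>1 \<le>\<^sub>K X\<^sup># \<circ> X)"
proof -
  let ?N = "null_space (B\<^sup># \<circ> B)"
  have B: "B \<in> \<L>" using assms(1) by (simp add: closed_range_ops_def)
  have Q: "Q \<in> \<L>" "\<And>x. Q (Q\<^sup># x) = Q\<^sup># (Q x)" "\<And>x. Q (B x) = B x" "\<And>x. Q x \<in> range B"
  proof -
    show "Q \<in> \<L>" using assms(8) by (simp add: normal_projections_def)
    show "Q (Q\<^sup># x) = Q\<^sup># (Q x)" for x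
      using assms(8) by (auto simp: normal_projections_def fun_eq_iff)
    show "Q (B x) = B x" for x
    proof -
      have "B x \<in> range Q" using assms(8) by (auto simp: normal_projections_def)
      then obtain y where "B x = Q y" by blast
      moreover have "Q (Q y) = Q y"
        using assms(8) by (auto simp: normal_projections_def fun_eq_iff)
      ultimately show ?thesis by simp
    qed
    show "Q x \<in> range B" for x using assms(8) by (auto simp: normal_projections_def)
  qed
  have B'_app: "B' x = Q\<^sup># (B x)" for x using assms(9) by simp
  have B': "B' \<in> \<L>" using assms(9) B Q(1) by (simp add: bounded_ops_comp kadjoint_bounded)
  define E where "E = D \<circ> B'"
  have E: "E \<in> \<L>" using assms(10) B' by (simp add: E_def bounded_ops_comp)
  have E_normal: "E\<^sup># (E x) = E (E\<^sup># x)" for x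
    using assms(14) by (auto simp: E_def fun_eq_iff)
  have X1: "X\<^sub>1 \<in> \<L>" using assms(2,10,15) by (simp add: bounded_ops_comp)
  \<comment> \<open>By nondegeneracy, \<open>?N\<close> is the preimage under \<open>B\<close> of
    the isotropic part of \<open>range B\<close>.\<close>
  have N_iff: "x \<in> ?N \<longleftrightarrow> (\<forall>y. kform (B x) (B y) = 0)" for x
  proof -
    have "B\<^sup># (B x) = 0 \<longleftrightarrow> (\<forall>y. kform y (B\<^sup># (B x)) = kform y 0)"
      by (metis kform_nondegenerate)
    also have "\<dots> \<longleftrightarrow> (\<forall>y. kform (B y) (B x) = 0)"
      by (simp add: kadjoint_right[OF B])
    also have "\<dots> \<longleftrightarrow> (\<forall>y. kform (B x) (B y) = 0)"
      by (simp only: kform_eq_0_commute[of "B x"])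
    finally show ?thesis by (simp add: null_space_def)
  qed
  \<comment> \<open>The kernel of an adjoint is the orthogonal companion of the range, and
    \<open>Q\<close> has range \<open>range B\<close>.\<close>
  have Q_adj_orth: "Q\<^sup># x = 0 \<longleftrightarrow> (\<forall>y. kform x (B y) = 0)" for x
  proof
    assume "Q\<^sup># x = 0"
    then show "\<forall>y. kform x (B y) = 0"
      using Q(1,3) by (metis kadjoint_left kform_zero_left)
  next
    assume *: "\<forall>y. kform x (B y) = 0"
    have "kform y (Q\<^sup># x) = kform y 0" for y
    proof -
      have "kform x (Q y) = 0" using * Q(4)[of y] by auto
      then show ?thesis
        by (simp add: kform_eq_0_commute[of x] flip: kadjoint_right[OF Q(1)])
    qed
    then show "Q\<^sup># x = 0" by (rule kform_nondegenerate)
  qed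
  have N_iff_B': "x \<in> ?N \<longleftrightarrow> B' x = 0" for x
    by (simp add: N_iff B'_app Q_adj_orth)
  have B'DB': "B' (D (B' x)) = B' x" for x using assms(11) by (auto simp: fun_eq_iff)
  \<comment> \<open>\<open>B' D B' = B'\<close> recovers \<open>B'\<close> from \<open>E\<close>, so
    both have the same kernel.\<close>
  have N_iff_E: "x \<in> ?N \<longleftrightarrow> E x = 0" for x
    unfolding N_iff_B' E_def using B'DB'[of x] assms(10) B'
    by (auto simp: bounded_ops_zero)
  have B'D: "B' (D x) = Q\<^sup># (Q x)" for x using assms(13) by (auto simp: fun_eq_iff)
  have D_eq: "D x = D (Q\<^sup># (Q x))" for x
    using assms(12) by (auto simp: fun_eq_iff B'D)
  have dense: "\<exists>u r. a = B u + r \<and> (\<forall>n\<in>?N. kform u n = 0) \<and> (\<forall>y. kform r (B y) = 0)"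
    if "a \<in> B ` (?N\<^sup>[\<^sup>\<bottom>\<^sup>]) + (range B)\<^sup>[\<^sup>\<bottom>\<^sup>]" for a
    using that unfolding set_plus_def korth_def by blast
  have C_mem: "C x \<in> krein_topology closure_of (B ` (?N\<^sup>[\<^sup>\<bottom>\<^sup>]) + (range B)\<^sup>[\<^sup>\<bottom>\<^sup>])" for x
    using assms(7) by blast
  have QC: "Q\<^sup># (Q (C x)) = Q\<^sup># (C x)" for x
  proof (rule kform_nondegenerate_left)
    fix w
    define T where "T = (\<lambda>y. (Q\<^sup># \<circ> Q) y - Q\<^sup># y)"
    have T: "T \<in> \<L>"
      unfolding T_def by (intro bounded_ops_fun_diff bounded_ops_comp kadjoint_bounded Q(1))
    have "kform (T (C x)) w = 0"
    proof (rule closure_of_orthogonal[OF C_mem T])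
      fix a assume "a \<in> B ` (?N\<^sup>[\<^sup>\<bottom>\<^sup>]) + (range B)\<^sup>[\<^sup>\<bottom>\<^sup>]"
      then obtain u r where a: "a = B u + r" "\<forall>y. kform r (B y) = 0"
        using dense by blast
      have r: "Q\<^sup># r = 0" using a(2) by (simp add: Q_adj_orth)
      \<comment> \<open>Normality of \<open>Q\<close> moves the adjoint next to \<open>r\<close>,
        which it annihilates.\<close>
      then have "Q\<^sup># (Q r) = 0" using Q(2)[of r] Q(1) by (simp add: bounded_ops_zero)
      then have "T a = 0"
        using r Q(1,3) by (simp add: T_def a(1) bounded_ops_add kadjoint_bounded)
      then show "kform (T a) w = 0" by simp
    qed
    then show "kform (Q\<^sup># (Q (C x))) w = kform (Q\<^sup># (C x)) w"
      by (simp add: T_def kform.diff_left)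
  qed
  \<comment> \<open>Applying \<open>Q\<^sup>#\<close> does the work of \<open>B\<^sup>#\<close>:
    both annihilate exactly the vectors orthogonal to \<open>range B\<close>.\<close>
  have normal_eq: "kform (B (X\<^sub>1 x) - C x) (B y) = 0" for x y
  proof -
    have "Q\<^sup># (B (X\<^sub>1 x) - C x) = B' (D (C x)) - Q\<^sup># (C x)"
      by (simp add: assms(15) B'_app bounded_ops_diff kadjoint_bounded Q(1))
    also have "\<dots> = 0" by (simp add: B'D QC)
    finally show ?thesis by (simp add: Q_adj_orth)
  qed
  \<comment> \<open>Pythagoras via the normal equation. Nonnegativity on \<open>range B\<close>
    makes \<open>X\<^sub>1\<close> an ImS, and the same identity later forces the last summand to
    vanish for any other ImS.\<close>
  have residual: "kform (B (X x) - C x) (B (X x) - C x)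
      = kform (B (X\<^sub>1 x) - C x) (B (X\<^sub>1 x) - C x) + kform (B (X x - X\<^sub>1 x)) (B (X x - X\<^sub>1 x))" for X x
  proof -
    have "B (X x) - C x = (B (X\<^sub>1 x) - C x) + B (X x - X\<^sub>1 x)"
      using B by (simp add: bounded_ops_diff)
    then show ?thesis by (simp only: kform_add_square[OF normal_eq])
  qed
  have "semidefinite_form kform (range B)"
    using assms(3) by unfold_locales
      (auto simp: nonnegative_subspace_def kform_add_left kform_scaleC_left intro: kform_commute)
  then interpret RB: semidefinite_form kform "range B" .
  have "kform (B (X\<^sub>1 x) - C x) (B (X\<^sub>1 x) - C x) \<le> kform (B (X x) - C x) (B (X x) - C x)" for X x
    unfolding residual[of X x] by (simp add: RB.nonneg)
  then have X1_ImS: "X\<^sub>1 \<in> ImS B C"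
    using X1 by (simp add: ImS_iff[OF B assms(2)])
  have X1_orth: "kform (X\<^sub>1 x) n = 0" if n: "n \<in> ?N" for x n
  proof -
    have DQ: "D \<circ> Q\<^sup># \<in> \<L>" using assms(10) Q(1) by (simp add: bounded_ops_comp kadjoint_bounded)
    have "kform ((D \<circ> Q\<^sup>#) (C x)) n = 0"
    proof (rule closure_of_orthogonal[OF C_mem DQ])
      fix a assume "a \<in> B ` (?N\<^sup>[\<^sup>\<bottom>\<^sup>]) + (range B)\<^sup>[\<^sup>\<bottom>\<^sup>]"
      then obtain u r where a: "a = B u + r" "\<forall>n\<in>?N. kform u n = 0" "\<forall>y. kform r (B y) = 0"
        using dense by blast
      have "Q\<^sup># r = 0" using a(3) by (simp add: Q_adj_orth)
      \<comment> \<open>\<open>Q\<^sup>#\<close> removes \<open>r\<close>, and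
        \<open>D Q\<^sup># B = D B' = E\<close>.\<close>
      then have "D (Q\<^sup># a) = E u"
        using Q(1) by (simp add: a(1) bounded_ops_add kadjoint_bounded E_def B'_app)
      \<comment> \<open>Since \<open>E n = 0\<close>, normality gives
        \<open>E (E\<^sup># n) = E\<^sup># (E n) = 0\<close>.\<close>
      moreover have "E\<^sup># n \<in> ?N"
        using n E by (simp add: N_iff_E bounded_ops_zero kadjoint_bounded flip: E_normal)
      ultimately show "kform ((D \<circ> Q\<^sup>#) a) n = 0"
        using a(2) by (simp add: kadjoint_right[OF E])
    qed
    then show ?thesis
      using D_eq[of "C x"] by (simp add: assms(15) QC)
  qed
  have "X\<^sub>1\<^sup># \<circ> X\<^sub>1 \<le>\<^sub>K X\<^sup># \<circ> X" if X: "X \<in> ImS B C" for X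
  proof -
    have XL: "X \<in> \<L>" using X by (simp add: ImS_iff[OF B assms(2)])
    have "kform (X\<^sub>1 x) (X\<^sub>1 x) \<le> kform (X x) (X x)" for x
    proof -
      let ?z = "X x - X\<^sub>1 x"
      \<comment> \<open>Here \<open>X\<close> is the minimiser and \<open>X\<^sub>1\<close> the
        competitor.\<close>
      have "kform (B (X x) - C x) (B (X x) - C x) \<le> kform (B (X\<^sub>1 x) - C x) (B (X\<^sub>1 x) - C x)"
        using X X1 by (simp add: ImS_iff[OF B assms(2)])
      then have "kform (B ?z) (B ?z) \<le> 0"
        unfolding residual[of X x] by simp
      then have "kform (B ?z) (B ?z) = 0"
        using RB.nonneg[of "B ?z"] by (intro antisym) simp_all
      \<comment> \<open>\<open>B ?z\<close> is neutral in the nonnegative subspace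
        \<open>range B\<close>, hence isotropic there.\<close>
      then have z: "?z \<in> ?N"
        by (simp add: N_iff RB.neutral_orthogonal)
      have "kform (X x) (X x) = kform (X\<^sub>1 x + ?z) (X\<^sub>1 x + ?z)" by simp
      also have "\<dots> = kform (X\<^sub>1 x) (X\<^sub>1 x) + kform ?z ?z"
        by (rule kform_add_square[OF X1_orth[OF z]])
      finally show ?thesis
        using z assms(5) by (simp add: nonnegative_subspace_def)
    qed
    then show ?thesis using XL X1 by (simp add: op_le_kadjoint_comp)
  qed
  then show ?thesis using X1_ImS by blast
qed

end
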